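(* For any set $A\subseteq\mathbb P$ and any positive integer $s$, the following strong $\mathcal C_{s,A}$-Wilf-equivalences hold (write $\sim_*$ for $\overset{\mathcal C_{s,A}}{\sim_*}$): (1) type $(2,1)$ patterns: (a) $12-2\sim_* 21-2$; (b) $13-2\sim_* 31-2$. (2) type $(3,1)$ patterns: (a) $123-1\sim_* 321-1$; (b) $123-2\sim_* 321-2$; (c) $123-3\sim_* 321-3$; (d) $124-3\sim_* 421-3$; (e) $134-2\sim_* 431-2$. (3) type $(2,2)$ patterns: (a) $13-12\sim_* 12-13$; (b) $12-23\sim_* 21-32$; (c) $13-23\sim_* 23-13$; (d) $14-23\sim_* 23-14$; (e) $13-24\sim_* 24-13$. (4) type $(1,1,2)$ patterns: (a) $1-1-12\sim_* 1-1-21$; (b) $2-2-12\sim_* 2-2-21$; (c) $2-2-13\sim_* 2-2-31$. (5) type $(1,2,1)$ patterns: (a) $1-12-2\sim_* 1-21-2$; (b) $1-13-2\sim_* 1-31-2$; (c) $2-13-3\sim_* 2-31-3$; (d) $2-14-3\sim_* 2-41-3$.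
   Context: $\mathbb P$ is the set of positive integers. For a positive integer $s$ and $A\subseteq\mathbb P$, $\mathcal C_{s,A}=\bigsqcup_{n\ge0}\mathcal C_{s,A;n}$ is the collection of integer compositions of $s$ all of whose parts lie in $A$, viewed as words; $\mathcal C_{s,A;n}$ is the set of those with $n$ parts, i.e. words $w_1\cdots w_n$ with $w_i\in A$ and $w_1+\cdots+w_n=s$. A dashed pattern $p$ of length $m$ is a word $p_1\cdots p_m$ whose set of letters is exactly $\{1,\dots,r\}$ for some $r\geq1$, in which two adjacent letters may or may not be separated by a dash. Its type is the sequence of lengths of its dash-free blocks. An occurrence of $p$ in a word $w=w_1\cdots w_n$ of positive integers is a choice of positions $1\le i_1<\dots<i_m\le n$ such that $w_{i_s}>w_{i_t}$ if and only if $p_s>p_t$ for all $s,t$, and $i_{s+1}=i_s+1$ whenever $p_s$ and $p_{s+1}$ are not separated by a dash. In the patterns listed, each digit is a letter (e.g. $124-3$ has letters $1,2,4,3$ with a dash only between $4$ and $3$). For a collection $\mathcal F=\bigsqcup_n\mathcal F_n$ of words ($\mathcal F_n$ being the words of length $n$), two patterns $p,q$ are strongly $\mathcal F$-Wilf-equivalent, written $p\overset{\mathcal F}{\sim_*}q$, if for all $n,k\ge0$ the number of words in $\mathcal F_n$ with exactly $k$ occurrences of $p$ equals the number with exactly $k$ occurrences of $q$. *)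

theory Defs
  imports Main
begin

text \<open>
  A word is a list of natural numbers.  A dashed pattern is the list of its dash-free blocks: for
  example, \<open>124-3\<close> is \<open>[[1, 2, 4], [3]]\<close>.  The type of the pattern \<open>p\<close> is then \<open>map length p\<close>,
  and its underlying word \<open>p\<^sub>1 \<dots> p\<^sub>m\<close> is \<open>concat p\<close>.
\<close>

type_synonym pattern = "nat list list"

definition dashed_pattern :: "pattern \<Rightarrow> bool" where
  "dashed_pattern p \<longleftrightarrow> [] \<notin> set p \<and> (\<exists>r\<ge>1. set (concat p) = {1..r})"

text \<open>
  Positions are counted from 0.  The letters at positions \<open>a\<close> and \<open>Suc a\<close> of \<open>concat p\<close> are
  separated by a dash iff \<open>Suc a\<close> is the starting position of some block of \<open>p\<close>.
\<close>

definition dash_after :: "pattern \<Rightarrow> nat \<Rightarrow> bool" where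
  "dash_after p a \<longleftrightarrow> (\<exists>j<length p. Suc a = length (concat (take j p)))"

text \<open>An occurrence is identified with the increasing list of the chosen positions.\<close>

definition occurrences :: "pattern \<Rightarrow> nat list \<Rightarrow> nat list set" where
  "occurrences p w = {is. length is = length (concat p) \<and> sorted_wrt (<) is \<and>
     (\<forall>i\<in>set is. i < length w) \<and>
     (\<forall>a<length is. \<forall>b<length is. w ! (is ! a) > w ! (is ! b) \<longleftrightarrow> concat p ! a > concat p ! b) \<and>
     (\<forall>a. Suc a < length is \<longrightarrow> \<not> dash_after p a \<longrightarrow> is ! Suc a = Suc (is ! a))}"

definition compositions :: "nat \<Rightarrow> nat set \<Rightarrow> nat list set" where
  "compositions s A = {w. set w \<subseteq> A \<and> sum_list w = s}"

text \<open>
  The cardinalities below are meaningful when the collection \<open>F\<close> has finitely many words of each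
  length, as is the case for \<open>compositions s A\<close>.
\<close>

definition strongly_wilf_equiv :: "nat list set \<Rightarrow> pattern \<Rightarrow> pattern \<Rightarrow> bool" where
  "strongly_wilf_equiv F p q \<longleftrightarrow> dashed_pattern p \<and> dashed_pattern q \<and>
     (\<forall>n k. card {w \<in> F. length w = n \<and> card (occurrences p w) = k} =
            card {w \<in> F. length w = n \<and> card (occurrences q w) = k})"

end

theory Submission
  imports Defs "HOL-Combinatorics.Permutations"
begin

text \<open>
  The number of words with \<open>k\<close> occurrences of \<open>p\<close> is determined by the numbers of pairs \<open>(w, M)\<close>
  where \<open>M\<close> is a set of \<open>k\<close> marked occurrences of \<open>p\<close> in \<open>w\<close>, so it suffices to biject such marked
  words.  Suppose that the dash-free blocks of \<open>p\<close> are exactly its maximal increasing runs.  Link the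
  adjacent positions of \<open>w\<close> that belong to a common block of a marked occurrence.  Then \<open>w\<close> increases
  along each maximal chain of linked positions, whereas no marked occurrence has two of its blocks in
  one chain.  Hence reversing every chain in place turns the marked occurrences of \<open>p\<close> into marked
  occurrences of \<open>map rev p\<close>; if the blocks of the latter are its maximal decreasing runs, then
  the same operation is the inverse map.  All the equivalences are of this form up to reversal of the
  whole word.
\<close>

section \<open>Binomial moments determine a distribution\<close>

lemma sum_choose_eq_sum_card:
  fixes f :: "'a \<Rightarrow> nat"
  assumes "finite W" and "\<And>w. w \<in> W \<Longrightarrow> f w \<le> N"
  shows "(\<Sum>w\<in>W. f w choose k) = (\<Sum>j\<le>N. card {w \<in> W. f w = j} * (j choose k))"
proof -
  have "(\<Sum>w\<in>W. f w choose k) = (\<Sum>j\<le>N. \<Sum>w\<in>{w \<in> W. f w = j}. f w choose k)"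
    by (rule sum.group[symmetric]) (use assms in auto)
  also have "\<dots> = (\<Sum>j\<le>N. card {w \<in> W. f w = j} * (j choose k))"
    by (rule sum.cong) auto
  finally show ?thesis .
qed

text \<open>The binomial sums are a unitriangular transform of the fibre sizes:
  \<open>j choose k\<close> vanishes for \<open>j < k\<close> and is 1 for \<open>j = k\<close>. So
  the fibre sizes can be recovered one by one, from the largest value \<open>N\<close>
  downwards.\<close>

lemma card_fibre_eq_if_sum_choose_eq:
  fixes f g :: "'a \<Rightarrow> nat"
  assumes fin: "finite W"
    and eq: "\<And>k. (\<Sum>w\<in>W. f w choose k) = (\<Sum>w\<in>W. g w choose k)"
  shows "card {w \<in> W. f w = k} = card {w \<in> W. g w = k}"
proof -
  define N where "N = Max (insert 0 (f ` W \<union> g ` W))"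
  have fN: "f w \<le> N" and gN: "g w \<le> N" if "w \<in> W" for w
    using fin that by (auto simp: N_def intro!: Max_ge)
  show ?thesis
  proof (induction "Suc N - k" arbitrary: k rule: less_induct)
    case less
    show ?case
    proof (cases "k \<le> N")
      case False
      then have "{w \<in> W. f w = k} = {}" "{w \<in> W. g w = k} = {}"
        using fN gN by auto
      then show ?thesis by (simp only:)
    next
      case True
      let ?c = "\<lambda>f j. card {w \<in> W. f w = j} * (j choose k)"
      have rest: "sum (?c f) ({..N} - {k}) = sum (?c g) ({..N} - {k})"
      proof (rule sum.cong)
        fix j assume "j \<in> {..N} - {k}"
        then consider "j < k" | "k < j" "j \<le> N" by force
        then show "?c f j = ?c g j"
          using less True by cases auto
      qed simp
      have "sum (?c f) {..N} = sum (?c g) {..N}"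
        using eq[of k] sum_choose_eq_sum_card[OF fin fN] sum_choose_eq_sum_card[OF fin gN] by simp
      then show ?thesis
        using rest True by (simp add: sum.remove[of _ k])
    qed
  qed
qed

section \<open>Reversing the maximal chains of linked positions\<close>

text \<open>The set \<open>L\<close> encodes links: \<open>i \<in> L\<close> means that \<open>i\<close> and \<open>Suc i\<close> are linked.\<close>

definition chain :: "nat set \<Rightarrow> nat \<Rightarrow> nat \<Rightarrow> bool" where
  "chain L l h \<longleftrightarrow> l \<le> h \<and> {l..<h} \<subseteq> L \<and> h \<notin> L \<and> (\<forall>k. Suc k = l \<longrightarrow> k \<notin> L)"

text \<open>The two \<open>LEAST\<close> terms are the ends of the maximal chain through
  \<open>i\<close>, so this is the reflection of that chain; a position without links is a chain of
  its own and stays fixed.\<close>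

definition flip :: "nat set \<Rightarrow> nat \<Rightarrow> nat" where
  "flip L i = (LEAST l. {l..<i} \<subseteq> L) + (LEAST h. i \<le> h \<and> h \<notin> L) - i"

lemma flip_eq:
  assumes "chain L l h" and "l \<le> i" and "i \<le> h"
  shows "flip L i = l + h - i"
proof -
  have "(LEAST l. {l..<i} \<subseteq> L) = l"
  proof (rule Least_equality)
    show "{l..<i} \<subseteq> L" using assms by (auto simp: chain_def)
    fix k assume k: "{k..<i} \<subseteq> L"
    show "l \<le> k"
    proof (rule ccontr)
      assume "\<not> l \<le> k"
      then have "l - 1 \<in> {k..<i}" "Suc (l - 1) = l" using assms by auto
      then show False using k assms(1) unfolding chain_def by blast
    qed
  qed
  moreover have "(LEAST h. i \<le> h \<and> h \<notin> L) = h"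
  proof (rule Least_equality)
    show "i \<le> h \<and> h \<notin> L" using assms by (auto simp: chain_def)
    fix k assume k: "i \<le> k \<and> k \<notin> L"
    then have "k \<notin> {l..<h}" using assms(1) unfolding chain_def by blast
    moreover have "l \<le> k" using k assms by simp
    ultimately show "h \<le> k" by simp
  qed
  ultimately show ?thesis by (simp add: flip_def)
qed

text \<open>Finiteness of \<open>L\<close> stops the chain through \<open>i\<close> on the right; on
  the left it stops at 0 at the latest.\<close>

lemma chain_exists:
  assumes "finite L"
  obtains l h where "chain L l h" "l \<le> i" "i \<le> h"
proof -
  define l where "l = (LEAST l. {l..<i} \<subseteq> L)"
  define h where "h = (LEAST h. i \<le> h \<and> h \<notin> L)"
  have l: "{l..<i} \<subseteq> L"
    unfolding l_def by (rule LeastI[of _ i]) simp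
  have li: "l \<le> i"
    unfolding l_def by (rule Least_le) simp
  have "\<exists>h. i \<le> h \<and> h \<notin> L"
    using assms by (metis finite_nat_set_iff_bounded leD max.cobounded1 max.cobounded2)
  then have h: "i \<le> h" "h \<notin> L"
    unfolding h_def by (metis (mono_tags, lifting) LeastI)+
  have "k \<in> L" if "i \<le> k" "k < h" for k
    using not_less_Least[of k "\<lambda>h. i \<le> h \<and> h \<notin> L"] that by (auto simp: h_def)
  then have "{l..<h} \<subseteq> L"
    using l by (metis atLeastLessThan_iff not_less subset_iff)
  moreover have "k \<notin> L" if "Suc k = l" for k
  proof
    assume "k \<in> L"
    then have "{k..<i} \<subseteq> L"
      using l that by (auto simp: subset_iff) (metis Suc_leI le_neq_implies_less)
    then have "l \<le> k" unfolding l_def by (rule Least_le)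
    then show False using that by simp
  qed
  ultimately show ?thesis
    using that[of l h] h li by (auto simp: chain_def)
qed

lemma flip_flip [simp]:
  assumes "finite L"
  shows "flip L (flip L i) = i"
proof -
  obtain l h where c: "chain L l h" "l \<le> i" "i \<le> h" using chain_exists[OF assms] .
  then have "l \<le> flip L i" "flip L i \<le> h" by (auto simp: flip_eq)
  with c show ?thesis by (simp add: flip_eq)
qed

text \<open>Reflection turns a link around. As a link is named by its left end, \<open>flip\<close>
  acts on links as \<open>\<lambda>i. flip L (Suc i)\<close>.\<close>

lemma flip_Suc:
  assumes "finite L" and "i \<in> L"
  shows "flip L i = Suc (flip L (Suc i))" and "flip L (Suc i) \<in> L"
proof -
  obtain l h where c: "chain L l h" "l \<le> i" "i \<le> h" using chain_exists[OF assms(1)] .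
  then have "i \<noteq> h" using assms by (auto simp: chain_def)
  with c have e: "flip L i = l + h - i" "flip L (Suc i) = l + h - Suc i" "i < h"
    by (auto simp: flip_eq)
  then show "flip L i = Suc (flip L (Suc i))" by simp
  have "flip L (Suc i) \<in> {l..<h}" using e c by auto
  then show "flip L (Suc i) \<in> L" using c by (auto simp: chain_def)
qed

text \<open>Here \<open>i\<close> and \<open>j\<close> lie in different chains. Chains are disjoint
  intervals, each mapped to itself, so their order is kept.\<close>

lemma flip_less_flip:
  assumes "finite L" and "i < j" and "\<not> {i..<j} \<subseteq> L"
  shows "flip L i < flip L j"
proof -
  obtain l h where c: "chain L l h" "l \<le> i" "i \<le> h" using chain_exists[OF assms(1)] .
  obtain l' h' where c': "chain L l' h'" "l' \<le> j" "j \<le> h'" using chain_exists[OF assms(1)] .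
  have "h < j"
  proof (rule ccontr)
    assume "\<not> h < j"
    then have "{i..<j} \<subseteq> {l..<h}" using c by auto
    then show False using c(1) assms(3) unfolding chain_def by blast
  qed
  then have "h < l'"
    using c(1) c' unfolding chain_def
    by (metis atLeastLessThan_iff less_le_trans not_less subset_iff)
  moreover have "flip L i \<le> h" "l' \<le> flip L j" using c c' by (auto simp: flip_eq)
  ultimately show ?thesis by simp
qed

lemma flip_permutes:
  assumes "L \<subseteq> {i. Suc i < n}"
  shows "flip L permutes {..<n}"
proof -
  have fin: "finite L" by (rule finite_subset[OF assms]) (rule finite_subset[of _ "{..<n}"], auto)
  have out: "flip L i = i" if "\<not> i < n" for i
  proof -
    \<comment> \<open>No link involves a position outside the word, so \<open>i\<close> forms a
      chain alone.\<close>
    have "chain L i i" using assms that by (auto simp: chain_def)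
    then show ?thesis by (simp add: flip_eq)
  qed
  have "bij_betw (flip L) {..<n} {..<n}"
  proof (rule bij_betw_byWitness[where f' = "flip L"])
    show "flip L ` {..<n} \<subseteq> {..<n}" using out fin by (metis flip_flip image_subsetI lessThan_iff)
    then show "flip L ` {..<n} \<subseteq> {..<n}" .
  qed (use fin in auto)
  then show ?thesis using out by (auto intro!: bij_imp_permutes)
qed

section \<open>Patterns with reversed blocks\<close>

text \<open>The link encoding applied to the pattern itself: within \<open>concat p\<close> its
  chains are the nonempty blocks, so \<open>flip (links p)\<close> reverses every block.\<close>

definition links :: "pattern \<Rightarrow> nat set" where
  "links p = {a. Suc a < length (concat p) \<and> \<not> dash_after p a}"

lemma occurrences_iff:
  "is \<in> occurrences p w \<longleftrightarrow> length is = length (concat p) \<and>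
     (\<forall>a. Suc a < length (concat p) \<longrightarrow> is ! a < is ! Suc a) \<and>
     (\<forall>a<length (concat p). is ! a < length w) \<and>
     (\<forall>a<length (concat p). \<forall>b<length (concat p).
        w ! (is ! a) > w ! (is ! b) \<longleftrightarrow> concat p ! a > concat p ! b) \<and>
     (\<forall>a\<in>links p. is ! Suc a = Suc (is ! a))"
  unfolding occurrences_def links_def sorted_wrt_iff_nth_Suc_transp[OF transp_on_less]
  by (auto simp: all_set_conv_all_nth)

lemma occurrences_mono:
  assumes "is \<in> occurrences p w" and "a < b" and "b < length (concat p)"
  shows "is ! a < is ! b"
  using assms by (auto simp: occurrences_def sorted_wrt_nth_less)

lemma finite_occurrences: "finite (occurrences p w)"
  by (rule finite_subset[OF _ finite_lists_length_eq[of "{..<length w}" "length (concat p)"]])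
     (auto simp: occurrences_def)

lemma length_concat_map_rev [simp]: "length (concat (map rev p)) = length (concat p)"
  by (induction p) auto

lemma dash_after_map_rev [simp]: "dash_after (map rev p) = dash_after p"
  by (simp add: fun_eq_iff dash_after_def take_map)

lemma links_map_rev [simp]: "links (map rev p) = links p"
  by (simp add: links_def)

lemma concat_position:
  assumes "a < length (concat p)"
  obtains j b where "j < length p" "b < length (p ! j)" "a = length (concat (take j p)) + b"
  using assms
proof (induction p arbitrary: a thesis)
  case (Cons x p)
  show ?case
  proof (cases "a < length x")
    case True
    then show ?thesis using Cons.prems(1)[of 0 a] by simp
  next
    case False
    then have "a - length x < length (concat p)" using Cons.prems(2) by simp
    then obtain j b where "j < length p" "b < length (p ! j)"
        "a - length x = length (concat (take j p)) + b"
      using Cons.IH by blast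
    then show ?thesis using Cons.prems(1)[of "Suc j" b] False by simp
  qed
qed simp

lemma concat_nth_block:
  assumes "j < length p" and "b < length (p ! j)"
  shows "concat p ! (length (concat (take j p)) + b) = p ! j ! b"
proof -
  have "concat p = concat (take j p) @ p ! j @ concat (drop (Suc j) p)"
    using assms(1) by (metis concat.simps(2) concat_append id_take_nth_drop)
  then show ?thesis using assms(2) by (simp add: nth_append)
qed

lemma length_concat_take_mono:
  "i \<le> j \<Longrightarrow> length (concat (take i p)) \<le> length (concat (take j p))"
  by (metis concat_append le_add1 length_append min.absorb1 take_add take_take le_Suc_ex)

lemma concat_map_rev_nth:
  assumes "a < length (concat p)"
  shows "concat (map rev p) ! a = concat p ! flip (links p) a"
proof -
  obtain j b where j: "j < length p" and b: "b < length (p ! j)"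
    and a: "a = length (concat (take j p)) + b"
    using concat_position[OF assms] .
  define l where "l = length (concat (take j p))"
  define h where "h = l + (length (p ! j) - 1)"
  have Sj: "length (concat (take (Suc j) p)) = Suc h"
    using j b by (simp add: take_Suc_conv_app_nth h_def l_def)
  have h: "Suc h \<le> length (concat p)"
    using length_concat_take_mono[of "Suc j" "length p" p] j Sj by simp
  have "chain (links p) l h"
    unfolding chain_def
  proof (intro conjI allI impI subsetI)
    show "l \<le> h" by (simp add: h_def)
    show "h \<notin> links p"
    proof (cases "Suc j < length p")
      case True
      then show ?thesis using Sj by (auto simp: links_def dash_after_def)
    next
      case False
      then have "Suc h = length (concat p)" using Sj j by simp
      then show ?thesis by (simp add: links_def)
    qed
    show "k \<notin> links p" if "Suc k = l" for k
      using that j by (auto simp: links_def dash_after_def l_def)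
    fix x assume x: "x \<in> {l..<h}"
    \<comment> \<open>No block starts strictly inside block \<open>j\<close>: the starts with
      \<open>i \<le> j\<close> are at most \<open>l\<close>, the later ones at least
      \<open>Suc h\<close>.\<close>
    have "Suc x \<noteq> length (concat (take i p))" for i
      using length_concat_take_mono[of i j p] length_concat_take_mono[of "Suc j" i p] x Sj
      by (cases "i \<le> j") (auto simp: l_def)
    then show "x \<in> links p"
      using x h by (auto simp: links_def dash_after_def)
  qed
  then have "flip (links p) a = l + (length (p ! j) - Suc b)"
    using b by (subst flip_eq[of _ l h]) (auto simp: a l_def h_def)
  moreover have "concat (map rev p) ! a = rev (p ! j) ! b"
    using concat_nth_block[of j "map rev p" b] j b a by (simp add: take_map)
  ultimately show ?thesis
    using concat_nth_block[of j p "length (p ! j) - Suc b"] j b by (simp add: rev_nth l_def)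
qed

section \<open>Marked words\<close>

text \<open>\<open>K\<close> stands for \<open>links p\<close>. An occurrence sends a link
  \<open>a\<close> of the pattern to the adjacent positions \<open>is ! a\<close> and
  \<open>is ! Suc a\<close>, hence to the link \<open>is ! a\<close> of the word.\<close>

definition chain_links :: "nat set \<Rightarrow> nat list set \<Rightarrow> nat set" where
  "chain_links K M = (\<Union>is\<in>M. (!) is ` K)"

text \<open>\<open>flip L\<close> moves the chosen positions along with their letters but reverses
  the order inside each block; \<open>flip K\<close> on the indices compensates for this.\<close>

definition flip_occurrence :: "nat set \<Rightarrow> nat set \<Rightarrow> nat list \<Rightarrow> nat list" where
  "flip_occurrence K L is = permute_list (flip K) (map (flip L) is)"

text \<open>Since \<open>p\<close> and \<open>map rev p\<close> have the same links, one function
  serves both directions.\<close>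

definition flip_marked :: "nat set \<Rightarrow> nat list \<times> nat list set \<Rightarrow> nat list \<times> nat list set" where
  "flip_marked K = (\<lambda>(w, M). (permute_list (flip (chain_links K M)) w,
     flip_occurrence K (chain_links K M) ` M))"

definition marked_words :: "nat list set \<Rightarrow> pattern \<Rightarrow> nat \<Rightarrow> (nat list \<times> nat list set) set" where
  "marked_words W p k = (SIGMA w:W. {M. M \<subseteq> occurrences p w \<and> card M = k})"

lemma links_subset: "links p \<subseteq> {a. Suc a < length (concat p)}"
  by (auto simp: links_def)

lemma finite_links: "finite (links p)"
  by (rule finite_subset[of _ "{..<length (concat p)}"]) (auto simp: links_def)

lemma chain_links_subset:
  assumes "M \<subseteq> occurrences p w"
  shows "chain_links (links p) M \<subseteq> {i. Suc i < length w}"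
proof
  fix i assume "i \<in> chain_links (links p) M"
  then obtain "is" a where "is \<in> occurrences p w" and a: "a \<in> links p" and i: "i = is ! a"
    using assms by (auto simp: chain_links_def)
  then have "is ! Suc a = Suc i" "is ! Suc a < length w"
    using links_subset[of p] by (auto simp: occurrences_iff)
  then show "i \<in> {i. Suc i < length w}" by simp
qed

lemma finite_chain_links:
  assumes "M \<subseteq> occurrences p w"
  shows "finite (chain_links (links p) M)"
  by (rule finite_subset[OF chain_links_subset[OF assms]])
     (rule finite_subset[of _ "{..<length w}"], auto)

lemma flip_occurrence_nth:
  assumes "length is = length (concat p)" and "a < length (concat p)"
  shows "flip_occurrence (links p) L is ! a = flip L (is ! flip (links p) a)"
    and "flip (links p) a < length (concat p)"
proof -
  have p: "flip (links p) permutes {..<length (concat p)}"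
    by (rule flip_permutes[OF links_subset])
  then show less: "flip (links p) a < length (concat p)"
    using assms(2) permutes_in_image[OF p, of a] by simp
  show "flip_occurrence (links p) L is ! a = flip L (is ! flip (links p) a)"
    using p less assms by (simp add: flip_occurrence_def permute_list_nth)
qed

lemma flip_occurrence_flip_occurrence:
  assumes "length is = length (concat p)" and "finite L"
  shows "flip_occurrence (links p) L (flip_occurrence (links p) L is) = is"
proof (rule nth_equalityI)
  show len: "length (flip_occurrence (links p) L (flip_occurrence (links p) L is)) = length is"
    by (simp add: flip_occurrence_def)
  fix a assume "a < length (flip_occurrence (links p) L (flip_occurrence (links p) L is))"
  then have a: "a < length (concat p)" using len assms by simp
  have len': "length (flip_occurrence (links p) L is) = length (concat p)"
    using assms by (simp add: flip_occurrence_def)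
  show "flip_occurrence (links p) L (flip_occurrence (links p) L is) ! a = is ! a"
    using flip_occurrence_nth[OF len' a] flip_occurrence_nth[OF assms(1)] finite_links assms(2) a
    by simp
qed

text \<open>Each link of the word comes from a marked occurrence, which transfers \<open>R\<close>
  from two adjacent letters of a block of \<open>p\<close>. Transitivity carries \<open>R\<close>
  along the chain, even if its links come from different occurrences. An abstract \<open>R\<close>
  treats increasing and decreasing runs together.\<close>

lemma chain_monotone:
  fixes w :: "nat list"
  assumes R: "transp R" and M: "M \<subseteq> occurrences p w"
    and step: "\<And>a. a \<in> links p \<Longrightarrow> R (concat p ! a) (concat p ! Suc a)"
    and iso: "\<And>is a b. is \<in> M \<Longrightarrow> a < length (concat p) \<Longrightarrow> b < length (concat p) \<Longrightarrow>
      R (w ! (is ! a)) (w ! (is ! b)) \<longleftrightarrow> R (concat p ! a) (concat p ! b)"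
    and "i < j" and "{i..<j} \<subseteq> chain_links (links p) M"
  shows "R (w ! i) (w ! j)"
proof -
  have one: "R (w ! x) (w ! Suc x)" if x: "x \<in> chain_links (links p) M" for x
  proof -
    obtain "is" a where is_a: "is \<in> M" "a \<in> links p" "x = is ! a"
      using x by (auto simp: chain_links_def)
    then have "is ! Suc a = Suc x" using M by (auto simp: occurrences_iff)
    then show ?thesis
      using iso[of "is" a "Suc a"] step[of a] is_a links_subset[of p] by auto
  qed
  have "Suc i \<le> j" using \<open>i < j\<close> by simp
  then show ?thesis using assms(6)
  proof (induction j rule: dec_induct)
    case base
    then show ?case using one by simp
  next
    case (step n)
    have "{i..<n} \<subseteq> {i..<Suc n}" "n \<in> {i..<Suc n}" using step.hyps by auto
    then have "R (w ! i) (w ! n)" "R (w ! n) (w ! Suc n)"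
      using step.IH step.prems one by blast+
    then show ?case using R by (rule transpD[rotated])
  qed
qed

text \<open>Within a block the reversals by \<open>flip L\<close> and \<open>flip (links p)\<close>
  cancel, so adjacency survives. Blocks on the two sides of a dash lie in different chains, whose
  order is kept. Letters travel with their positions, and the flip of the indices permutes them as
  reversing the blocks of \<open>p\<close> does.\<close>

lemma flip_occurrence_in_occurrences:
  fixes R :: "nat \<Rightarrow> nat \<Rightarrow> bool"
  assumes R: "R = (<) \<or> R = (>)"
    and runs: "\<And>a. Suc a < length (concat p) \<Longrightarrow>
      \<not> dash_after p a \<longleftrightarrow> R (concat p ! a) (concat p ! Suc a)"
    and M: "M \<subseteq> occurrences p w" and "is": "is \<in> M"
  defines "L \<equiv> chain_links (links p) M"
  shows "flip_occurrence (links p) L is \<in> occurrences (map rev p) (permute_list (flip L) w)"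
proof -
  let ?K = "links p" and ?m = "length (concat p)"
  let ?is = "flip_occurrence ?K L is" and ?w = "permute_list (flip L) w"
  have occ: "is \<in> occurrences p w" using M "is" by auto
  then have len: "length is = ?m" by (simp add: occurrences_iff)
  have finL: "finite L" unfolding L_def by (rule finite_chain_links[OF M])
  have perm: "flip L permutes {..<length w}"
    unfolding L_def by (rule flip_permutes[OF chain_links_subset[OF M]])
  have iso: "R (w ! (js ! a)) (w ! (js ! b)) \<longleftrightarrow> R (concat p ! a) (concat p ! b)"
    if "js \<in> M" "a < ?m" "b < ?m" for js a b
    using R M that by (auto simp: occurrences_iff)
  have nth: "?is ! a = flip L (is ! flip ?K a)" and flipK: "flip ?K a < ?m" if "a < ?m" for a
    using flip_occurrence_nth[OF len that] by auto
  have inw: "flip L i < length w" if "i < length w" for i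
    using permutes_in_image[OF perm, of i] that by simp
  have isw: "is ! a < length w" if "a < ?m" for a
    using occ that by (simp add: occurrences_iff)
  have link: "?is ! Suc a = Suc (?is ! a)" if a: "a \<in> ?K" for a
  proof -
    let ?c = "flip ?K (Suc a)"
    have c: "?c \<in> ?K" "flip ?K a = Suc ?c" using flip_Suc[OF finite_links a] by auto
    then have "is ! Suc ?c = Suc (is ! ?c)" using occ by (auto simp: occurrences_iff)
    moreover have "is ! ?c \<in> L" using c "is" by (auto simp: L_def chain_links_def)
    ultimately have "flip L (is ! ?c) = Suc (flip L (is ! flip ?K a))"
      using flip_Suc(1)[OF finL] c by simp
    then show ?thesis using nth a links_subset[of p] by auto
  qed
  have mono: "?is ! a < ?is ! Suc a" if a: "Suc a < ?m" for a
  proof (cases "a \<in> ?K")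
    case True
    then show ?thesis using link by simp
  next
    case False
    obtain l h where c: "chain ?K l h" "l \<le> a" "a \<le> h" using chain_exists[OF finite_links] .
    obtain l' h' where c': "chain ?K l' h'" "l' \<le> Suc a" "Suc a \<le> h'"
      using chain_exists[OF finite_links] .
    have h: "h = a"
    proof (rule ccontr)
      assume "h \<noteq> a"
      then have "a \<in> {l..<h}" using c by simp
      then show False using c(1) False unfolding chain_def by blast
    qed
    have l': "l' = Suc a"
    proof (rule ccontr)
      assume "l' \<noteq> Suc a"
      then have "a \<in> {l'..<h'}" using c' by simp
      then show False using c'(1) False unfolding chain_def by blast
    qed
    \<comment> \<open>The dash separates the blocks \<open>{l..a}\<close> and
      \<open>{Suc a..h'}\<close>. Their reversal brings the outermost indices \<open>l\<close> and
      \<open>h'\<close> next to the dash, so these must be compared.\<close>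
    have e: "flip ?K a = l" "flip ?K (Suc a) = h'"
      using c c' h l' by (auto simp: flip_eq)
    then have h'm: "h' < ?m" using flipK[OF a] by simp
    have le: "is ! l \<le> is ! a" "is ! Suc a \<le> is ! h'" and less: "is ! a < is ! Suc a"
      using occurrences_mono[OF occ, of l a] occurrences_mono[OF occ, of "Suc a" h']
        occurrences_mono[OF occ, of a "Suc a"] c c' a h'm by (auto simp: le_less)
    \<comment> \<open>If the two blocks shared a chain, the letters of \<open>w\<close> would be in
      relation \<open>R\<close> across the dash, and so would those of \<open>p\<close>; but by
      \<open>runs\<close> the relation fails at every dash.\<close>
    have "\<not> {is ! l..<is ! h'} \<subseteq> L"
    proof
      assume "{is ! l..<is ! h'} \<subseteq> L"
      then have sub: "{is ! a..<is ! Suc a} \<subseteq> chain_links ?K M"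
        using le by (force simp: L_def)
      have "R (w ! (is ! a)) (w ! (is ! Suc a))"
        by (rule chain_monotone[OF _ M _ _ less sub])
          (use R runs iso in \<open>auto simp: links_def\<close>)
      then have "R (concat p ! a) (concat p ! Suc a)" using iso[OF "is"] a by simp
      then show False using runs a False by (simp add: links_def)
    qed
    then have "flip L (is ! l) < flip L (is ! h')"
      using flip_less_flip[OF finL] le less by simp
    then show ?thesis using nth a e by simp
  qed
  \<comment> \<open>\<open>flip L\<close> enters twice, moving the letters and moving the positions,
    and cancels as an involution.\<close>
  have "?w ! (?is ! a) = w ! (is ! flip ?K a)" if "a < ?m" for a
    using that nth inw isw flipK finL perm by (simp add: permute_list_nth)
  then have "?w ! (?is ! a) > ?w ! (?is ! b) \<longleftrightarrow>
      concat (map rev p) ! a > concat (map rev p) ! b" if "a < ?m" "b < ?m" for a b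
    using that flipK occ by (simp add: concat_map_rev_nth occurrences_iff)
  moreover have "length ?is = ?m" by (simp add: flip_occurrence_def len)
  moreover have "?is ! a < length ?w" if "a < ?m" for a
    unfolding nth[OF that] using inw isw flipK that by simp
  ultimately show ?thesis
    unfolding occurrences_iff length_concat_map_rev links_map_rev using mono link by blast
qed

text \<open>This lets a second flip use the same chains as the first. It holds because
  \<open>\<lambda>a. flip (links p) (Suc a)\<close> permutes the links of the pattern and
  \<open>\<lambda>x. flip L (Suc x)\<close> those of the word.\<close>

lemma chain_links_flip:
  assumes M: "M \<subseteq> occurrences p w"
  defines "L \<equiv> chain_links (links p) M"
  shows "chain_links (links p) (flip_occurrence (links p) L ` M) = L"
proof -
  let ?K = "links p"
  have finL: "finite L" unfolding L_def by (rule finite_chain_links[OF M])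
  \<comment> \<open>The link \<open>flip ?K (Suc a)\<close> has right end \<open>flip ?K a\<close>,
    and the occurrence keeps its two ends adjacent.\<close>
  have nth: "flip_occurrence ?K L is ! a = flip L (Suc (is ! flip ?K (Suc a)))"
    if "is \<in> M" "a \<in> ?K" for "is" a
  proof -
    have occ: "is \<in> occurrences p w" using that M by auto
    have "a < length (concat p)" using that links_subset[of p] by auto
    then show ?thesis
      using flip_occurrence_nth(1)[of "is" p a L] flip_Suc[OF finite_links that(2)] occ
      by (auto simp: occurrences_iff)
  qed
  have K_inv: "flip ?K (Suc (flip ?K (Suc a))) = a" if "a \<in> ?K" for a
    using flip_Suc(1)[OF finite_links that] finite_links[of p] by (metis flip_flip)
  have L_inv: "flip L (Suc (flip L (Suc x))) = x" if "x \<in> L" for x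
    using flip_Suc(1)[OF finL that] finL by (metis flip_flip)
  have K_img: "(\<lambda>a. flip ?K (Suc a)) ` ?K = ?K"
    using K_inv flip_Suc(2)[OF finite_links] by (force simp: image_iff)
  have "chain_links ?K (flip_occurrence ?K L ` M) =
      (\<Union>is\<in>M. (\<lambda>a. flip L (Suc (is ! flip ?K (Suc a)))) ` ?K)"
    using nth by (auto simp: chain_links_def image_iff)
  also have "\<dots> = (\<Union>is\<in>M. (\<lambda>c. flip L (Suc (is ! c))) ` (\<lambda>a. flip ?K (Suc a)) ` ?K)"
    by (simp add: image_image)
  also have "\<dots> = (\<lambda>x. flip L (Suc x)) ` L"
    unfolding K_img by (auto simp: L_def chain_links_def)
  also have "\<dots> = L"
    using L_inv flip_Suc(2)[OF finL] by (force simp: image_iff)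
  finally show ?thesis .
qed

text \<open>By \<open>chain_links_flip\<close> the second application works with the same chains, so
  it undoes the first on the word and on each occurrence.\<close>

lemma flip_marked_flip_marked:
  assumes "x \<in> marked_words W p k"
  shows "flip_marked (links p) (flip_marked (links p) x) = x"
proof -
  obtain w M where x: "x = (w, M)" by (cases x)
  have M: "M \<subseteq> occurrences p w" using assms by (auto simp: x marked_words_def)
  let ?K = "links p" and ?L = "chain_links (links p) M"
  have fin: "finite ?L" by (rule finite_chain_links[OF M])
  have perm: "flip ?L permutes {..<length w}" by (rule flip_permutes[OF chain_links_subset[OF M]])
  have "flip ?L \<circ> flip ?L = id" using fin by (auto simp: fun_eq_iff)
  then have "permute_list (flip ?L) (permute_list (flip ?L) w) = w"
    using permute_list_compose[OF perm, of "flip ?L"] by simp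
  moreover have "flip_occurrence ?K ?L ` flip_occurrence ?K ?L ` M = M"
  proof -
    have "flip_occurrence ?K ?L (flip_occurrence ?K ?L is) = is" if "is \<in> M" for "is"
      using flip_occurrence_flip_occurrence[OF _ fin] M that by (auto simp: occurrences_iff)
    then show ?thesis by (auto simp: image_image)
  qed
  ultimately show ?thesis
    using chain_links_flip[OF M] by (simp add: x flip_marked_def)
qed

text \<open>Closure of \<open>W\<close> under rearrangement keeps the permuted word in
  \<open>W\<close>; injectivity of \<open>flip_occurrence\<close> on \<open>M\<close> preserves the
  number of marks.\<close>

lemma flip_marked_in_marked_words:
  fixes R :: "nat \<Rightarrow> nat \<Rightarrow> bool"
  assumes R: "R = (<) \<or> R = (>)"
    and runs: "\<And>a. Suc a < length (concat p) \<Longrightarrow>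
      \<not> dash_after p a \<longleftrightarrow> R (concat p ! a) (concat p ! Suc a)"
    and W: "\<And>v w. w \<in> W \<Longrightarrow> mset v = mset w \<Longrightarrow> v \<in> W"
    and x: "x \<in> marked_words W p k"
  shows "flip_marked (links p) x \<in> marked_words W (map rev p) k"
proof -
  obtain w M where x': "x = (w, M)" by (cases x)
  have M: "M \<subseteq> occurrences p w" and w: "w \<in> W" and k: "card M = k"
    using x by (auto simp: x' marked_words_def)
  let ?K = "links p" and ?L = "chain_links (links p) M"
  have perm: "flip ?L permutes {..<length w}" by (rule flip_permutes[OF chain_links_subset[OF M]])
  have "permute_list (flip ?L) w \<in> W" by (rule W[OF w]) (simp add: perm)
  moreover have "flip_occurrence ?K ?L ` M \<subseteq> occurrences (map rev p) (permute_list (flip ?L) w)"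
    using flip_occurrence_in_occurrences[OF R runs M] by auto
  moreover have "inj_on (flip_occurrence ?K ?L) M"
  proof (rule inj_on_inverseI)
    fix "is" assume "is \<in> M"
    then show "flip_occurrence ?K ?L (flip_occurrence ?K ?L is) = is"
      using flip_occurrence_flip_occurrence[OF _ finite_chain_links[OF M]] M
      by (auto simp: occurrences_iff)
  qed
  ultimately show ?thesis
    using k by (simp add: x' flip_marked_def marked_words_def card_image)
qed

lemma map_rev_map_rev [simp]: "map rev (map rev p) = p"
  by (induction p) auto

text \<open>\<open>flip_marked\<close> leads forward by the increasing runs of \<open>p\<close> and
  back by the decreasing runs of \<open>map rev p\<close>.\<close>

lemma card_marked_words_map_rev:
  assumes inc: "\<And>a. Suc a < length (concat p) \<Longrightarrow>
      \<not> dash_after p a \<longleftrightarrow> concat p ! a < concat p ! Suc a"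
    and dec: "\<And>a. Suc a < length (concat p) \<Longrightarrow>
      \<not> dash_after p a \<longleftrightarrow> concat (map rev p) ! a > concat (map rev p) ! Suc a"
    and W: "\<And>v w. w \<in> W \<Longrightarrow> mset v = mset w \<Longrightarrow> v \<in> W"
  shows "card (marked_words W p k) = card (marked_words W (map rev p) k)"
proof (rule bij_betw_same_card)
  let ?f = "flip_marked (links p)"
  show "bij_betw ?f (marked_words W p k) (marked_words W (map rev p) k)"
  proof (rule bij_betw_byWitness)
    show "\<forall>x\<in>marked_words W p k. ?f (?f x) = x"
      using flip_marked_flip_marked by blast
    show "\<forall>x\<in>marked_words W (map rev p) k. ?f (?f x) = x"
      using flip_marked_flip_marked[of _ W "map rev p"] by simp
    show "?f ` marked_words W p k \<subseteq> marked_words W (map rev p) k"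
      using flip_marked_in_marked_words[where R = "(<)" and p = p and W = W] inc W by auto
    show "?f ` marked_words W (map rev p) k \<subseteq> marked_words W p k"
      using flip_marked_in_marked_words[where R = "(>)" and p = "map rev p" and W = W] dec W by auto
  qed
qed

lemma card_marked_words:
  assumes "finite W"
  shows "card (marked_words W p k) = (\<Sum>w\<in>W. card (occurrences p w) choose k)"
  unfolding marked_words_def using assms finite_occurrences
  by (subst card_SigmaI) (auto simp: n_subsets)

section \<open>Strong Wilf equivalences\<close>

lemma dashed_pattern_map_rev: "dashed_pattern (map rev p) = dashed_pattern p"
  by (auto simp: dashed_pattern_def)

lemma dashed_pattern_rev: "dashed_pattern (rev p) = dashed_pattern p"
  by (simp add: dashed_pattern_def)

text \<open>Among the finitely many words of one length, counting marked words gives the binomial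
  sums of the occurrence numbers, and these determine the distribution.\<close>

lemma strongly_wilf_equiv_map_rev:
  assumes p: "dashed_pattern p"
    and inc: "\<And>a. Suc a < length (concat p) \<Longrightarrow>
      \<not> dash_after p a \<longleftrightarrow> concat p ! a < concat p ! Suc a"
    and dec: "\<And>a. Suc a < length (concat p) \<Longrightarrow>
      \<not> dash_after p a \<longleftrightarrow> concat (map rev p) ! a > concat (map rev p) ! Suc a"
    and F: "\<And>v w. w \<in> F \<Longrightarrow> mset v = mset w \<Longrightarrow> v \<in> F"
    and fin: "\<And>n. finite {w \<in> F. length w = n}"
  shows "strongly_wilf_equiv F p (map rev p)"
  unfolding strongly_wilf_equiv_def
proof (intro conjI allI)
  fix n k
  let ?W = "{w \<in> F. length w = n}"
  have "v \<in> ?W" if "w \<in> ?W" "mset v = mset w" for v w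
    using F[of w v] that mset_eq_length by auto
  then have "card (marked_words ?W p k) = card (marked_words ?W (map rev p) k)" for k
    by (intro card_marked_words_map_rev inc dec) blast+
  then have "card {w \<in> ?W. card (occurrences p w) = k} =
      card {w \<in> ?W. card (occurrences (map rev p) w) = k}"
    using card_marked_words[OF fin] by (intro card_fibre_eq_if_sum_choose_eq fin) simp
  then show "card {w \<in> F. length w = n \<and> card (occurrences p w) = k} =
      card {w \<in> F. length w = n \<and> card (occurrences (map rev p) w) = k}"
    by (simp add: conj_assoc)
qed (use p dashed_pattern_map_rev in auto)

section \<open>Reversal of whole words\<close>

definition mirror :: "pattern \<Rightarrow> pattern" where
  "mirror p = rev (map rev p)"

lemma concat_mirror: "concat (mirror p) = rev (concat p)"
  by (simp add: mirror_def rev_concat rev_map)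

lemma mirror_mirror [simp]: "mirror (mirror p) = p"
  by (simp add: mirror_def rev_map)

lemma dash_after_mirror:
  assumes "dash_after p a" and "Suc a < length (concat p)"
  shows "dash_after (mirror p) (length (concat p) - 2 - a)"
proof -
  obtain j where j: "j < length p" "Suc a = length (concat (take j p))"
    using assms by (auto simp: dash_after_def)
  \<comment> \<open>The \<open>j\<close> blocks before the dash become the last \<open>j\<close>
    blocks of the mirror image, so \<open>length p - j\<close> blocks precede the mirrored
    dash.\<close>
  have "take (length p - j) (mirror p) = mirror (drop j p)"
    using j by (simp add: mirror_def take_rev drop_map)
  moreover have "length (concat p) = length (concat (take j p)) + length (concat (drop j p))"
    by (metis append_take_drop_id concat_append length_append)
  ultimately have "Suc (length (concat p) - 2 - a) = length (concat (take (length p - j) (mirror p)))"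
    using j assms(2) by (simp add: concat_mirror)
  moreover have "j \<noteq> 0" using j by (cases j) auto
  then have "length p - j < length (mirror p)" using j by (simp add: mirror_def)
  ultimately show ?thesis unfolding dash_after_def by blast
qed

text \<open>With \<open>m = length (concat p)\<close>, the ends \<open>a\<close> and
  \<open>Suc a\<close> of a link are mirrored to \<open>m - 1 - a\<close> and
  \<open>m - 2 - a\<close>; the latter is the new left end.\<close>

lemma links_mirror:
  assumes "a \<in> links (mirror p)"
  shows "length (concat p) - 2 - a \<in> links p"
proof -
  have a: "Suc a < length (concat p)" "\<not> dash_after (mirror p) a"
    using assms by (auto simp: links_def concat_mirror)
  then have "length (concat p) - 2 - (length (concat p) - 2 - a) = a"
    and less: "Suc (length (concat p) - 2 - a) < length (concat p)" by auto
  then have "\<not> dash_after p (length (concat p) - 2 - a)"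
    using dash_after_mirror[of p "length (concat p) - 2 - a"] a by auto
  then show ?thesis using less by (simp add: links_def)
qed

lemma occurrences_mirror:
  assumes occ: "is \<in> occurrences p w"
  shows "rev (map (\<lambda>i. length w - 1 - i) is) \<in> occurrences (mirror p) (rev w)"
proof -
  let ?m = "length (concat p)" and ?n = "length w"
  let ?is = "rev (map (\<lambda>i. ?n - 1 - i) is)"
  have len: "length is = ?m" using occ by (simp add: occurrences_iff)
  have nth: "?is ! a = ?n - 1 - is ! (?m - Suc a)" if "a < ?m" for a
    using that len by (simp add: rev_nth)
  have isn: "is ! a < ?n" if "a < ?m" for a using occ that by (simp add: occurrences_iff)
  have letter: "rev w ! (?is ! a) = w ! (is ! (?m - Suc a))" if "a < ?m" for a
  proof -
    have "is ! (?m - Suc a) < ?n" using isn that by simp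
    then show ?thesis using nth[OF that] by (simp add: rev_nth Suc_diff_Suc)
  qed
  have "?is ! a < ?is ! Suc a" if a: "Suc a < ?m" for a
  proof -
    have "is ! (?m - Suc (Suc a)) < is ! (?m - Suc a)"
      using occurrences_mono[OF occ, of "?m - Suc (Suc a)" "?m - Suc a"] a by simp
    moreover have "is ! (?m - Suc a) < ?n" using isn a by simp
    ultimately show ?thesis using nth a by simp
  qed
  moreover have "?is ! a < ?n" if "a < ?m" for a
  proof -
    have "is ! (?m - Suc a) < ?n" using isn that by simp
    then show ?thesis using nth[OF that] by simp
  qed
  moreover have "rev w ! (?is ! a) > rev w ! (?is ! b) \<longleftrightarrow>
      concat (mirror p) ! a > concat (mirror p) ! b" if "a < ?m" "b < ?m" for a b
    using that occ unfolding letter[OF that(1)] letter[OF that(2)]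
    by (simp add: concat_mirror rev_nth occurrences_iff)
  moreover have "?is ! Suc a = Suc (?is ! a)" if a: "a \<in> links (mirror p)" for a
  proof -
    let ?c = "?m - 2 - a"
    have "?c \<in> links p" by (rule links_mirror[OF a])
    then have c: "is ! Suc ?c = Suc (is ! ?c)" using occ by (simp add: occurrences_iff)
    have "Suc a < ?m" using a by (simp add: links_def concat_mirror)
    then have e: "?m - Suc a = Suc ?c" "?m - Suc (Suc a) = ?c" and "Suc ?c < ?m" by auto
    then have "is ! Suc ?c < ?n" using isn by blast
    moreover have "?is ! a = ?n - 1 - is ! Suc ?c" "?is ! Suc a = ?n - 1 - is ! ?c"
      using nth[of a] nth[of "Suc a"] \<open>Suc a < ?m\<close> unfolding e by simp_all
    ultimately show ?thesis unfolding c by linarith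
  qed
  ultimately show ?thesis using len by (simp add: occurrences_iff concat_mirror)
qed

text \<open>Mirroring occurrences is injective, which gives one inequality; applied to the mirrored
  pattern and the reversed word it gives the other.\<close>

lemma card_occurrences_mirror: "card (occurrences (mirror p) (rev w)) = card (occurrences p w)"
proof -
  have le: "card (occurrences p w) \<le> card (occurrences (mirror p) (rev w))" for p w
  proof (rule card_inj_on_le[OF _ _ finite_occurrences])
    let ?f = "\<lambda>is. rev (map (\<lambda>i. length w - 1 - i) is)"
    show "?f ` occurrences p w \<subseteq> occurrences (mirror p) (rev w)"
      using occurrences_mirror by auto
    show "inj_on ?f (occurrences p w)"
      by (rule inj_on_inverseI[where g = ?f])
        (auto simp: occurrences_def rev_map intro!: map_idI)
  qed
  show ?thesis using le[of p w] le[of "mirror p" "rev w"] by simp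
qed

lemma strongly_wilf_equiv_mirror:
  assumes p: "dashed_pattern p" and F: "\<And>w. w \<in> F \<Longrightarrow> rev w \<in> F"
  shows "strongly_wilf_equiv F p (mirror p)"
  unfolding strongly_wilf_equiv_def
proof (intro conjI allI)
  fix n k
  show "card {w \<in> F. length w = n \<and> card (occurrences p w) = k} =
      card {w \<in> F. length w = n \<and> card (occurrences (mirror p) w) = k}"
  proof (rule bij_betw_same_card, rule bij_betw_byWitness[where f = rev])
    show "rev ` {w \<in> F. length w = n \<and> card (occurrences (mirror p) w) = k} \<subseteq>
        {w \<in> F. length w = n \<and> card (occurrences p w) = k}"
      using F card_occurrences_mirror[of "mirror p"] by auto
  qed (use F card_occurrences_mirror in auto)
qed (use p in \<open>auto simp: mirror_def dashed_pattern_rev dashed_pattern_map_rev\<close>)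

lemma strongly_wilf_equiv_trans:
  "strongly_wilf_equiv F p q \<Longrightarrow> strongly_wilf_equiv F q r \<Longrightarrow> strongly_wilf_equiv F p r"
  by (simp add: strongly_wilf_equiv_def)

section \<open>Compositions and the listed patterns\<close>

lemma mset_compositions: "w \<in> compositions s A \<Longrightarrow> mset v = mset w \<Longrightarrow> v \<in> compositions s A"
  by (auto simp: compositions_def simp flip: sum_mset_sum_list set_mset_mset)

lemma finite_compositions_length: "finite {w \<in> compositions s A. length w = n}"
  by (rule finite_subset[OF _ finite_lists_length_eq[of "{..s}" n]])
     (auto simp: compositions_def member_le_sum_list)

text \<open>The hypotheses on \<open>p\<close> of \<open>strongly_wilf_equiv_map_rev\<close>, with a
  bounded quantifier so that simplification can check them on concrete patterns.\<close>

definition blocks_are_runs :: "pattern \<Rightarrow> bool" where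
  "blocks_are_runs p \<longleftrightarrow> dashed_pattern p \<and> (\<forall>a<length (concat p) - 1.
     (\<not> dash_after p a \<longleftrightarrow> concat p ! a < concat p ! Suc a) \<and>
     (\<not> dash_after p a \<longleftrightarrow> concat (map rev p) ! a > concat (map rev p) ! Suc a))"

lemma compositions_map_rev:
  assumes "blocks_are_runs p"
  shows "strongly_wilf_equiv (compositions s A) p (map rev p)"
proof (rule strongly_wilf_equiv_map_rev)
  fix a assume "Suc a < length (concat p)"
  then have "a < length (concat p) - 1" by simp
  then show "\<not> dash_after p a \<longleftrightarrow> concat p ! a < concat p ! Suc a"
    and "\<not> dash_after p a \<longleftrightarrow> concat (map rev p) ! a > concat (map rev p) ! Suc a"
    using assms unfolding blocks_are_runs_def by blast+
qed (use assms mset_compositions finite_compositions_length in \<open>auto simp: blocks_are_runs_def\<close>)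

text \<open>\<open>p\<close> is equivalent to \<open>map rev p\<close>, and that to its mirror
  image. The two reversals inside the blocks cancel, leaving only the order of the blocks
  reversed.\<close>

lemma compositions_rev:
  assumes "blocks_are_runs p"
  shows "strongly_wilf_equiv (compositions s A) p (rev p)"
proof -
  have "strongly_wilf_equiv (compositions s A) (map rev p) (mirror (map rev p))"
    using assms mset_compositions
    by (intro strongly_wilf_equiv_mirror) (auto simp: blocks_are_runs_def dashed_pattern_map_rev)
  then show ?thesis
    using strongly_wilf_equiv_trans[OF compositions_map_rev[OF assms]]
    by (metis map_rev_map_rev mirror_def)
qed

lemma runs_map_rev:
  "blocks_are_runs [[1, 2], [2]]"
  "blocks_are_runs [[1, 3], [2]]"
  "blocks_are_runs [[1, 2, 3], [1]]"
  "blocks_are_runs [[1, 2, 3], [2]]"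
  "blocks_are_runs [[1, 2, 3], [3]]"
  "blocks_are_runs [[1, 2, 4], [3]]"
  "blocks_are_runs [[1, 3, 4], [2]]"
  "blocks_are_runs [[1, 2], [2, 3]]"
  "blocks_are_runs [[1], [1], [1, 2]]"
  "blocks_are_runs [[2], [2], [1, 2]]"
  "blocks_are_runs [[2], [2], [1, 3]]"
  "blocks_are_runs [[1], [1, 2], [2]]"
  "blocks_are_runs [[1], [1, 3], [2]]"
  "blocks_are_runs [[2], [1, 3], [3]]"
  "blocks_are_runs [[2], [1, 4], [3]]"
  by (simp add: blocks_are_runs_def dashed_pattern_def dash_after_def set_eq_iff
      All_less_Suc Ex_less_Suc numeral_eq_Suc nth_Cons'; presburger)+

lemma runs_rev:
  "blocks_are_runs [[1, 3], [1, 2]]"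
  "blocks_are_runs [[1, 3], [2, 3]]"
  "blocks_are_runs [[1, 4], [2, 3]]"
  "blocks_are_runs [[1, 3], [2, 4]]"
  by (simp add: blocks_are_runs_def dashed_pattern_def dash_after_def set_eq_iff
      All_less_Suc Ex_less_Suc numeral_eq_Suc nth_Cons'; presburger)+

theorem corollary1p5:
  fixes A :: "nat set" and s :: nat
  assumes "\<forall>a\<in>A. a > 0" and "s > 0"
  shows
    "strongly_wilf_equiv (compositions s A) [[1, 2], [2]] [[2, 1], [2]] \<and>
     strongly_wilf_equiv (compositions s A) [[1, 3], [2]] [[3, 1], [2]] \<and>

     strongly_wilf_equiv (compositions s A) [[1, 2, 3], [1]] [[3, 2, 1], [1]] \<and>
     strongly_wilf_equiv (compositions s A) [[1, 2, 3], [2]] [[3, 2, 1], [2]] \<and>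
     strongly_wilf_equiv (compositions s A) [[1, 2, 3], [3]] [[3, 2, 1], [3]] \<and>
     strongly_wilf_equiv (compositions s A) [[1, 2, 4], [3]] [[4, 2, 1], [3]] \<and>
     strongly_wilf_equiv (compositions s A) [[1, 3, 4], [2]] [[4, 3, 1], [2]] \<and>

     strongly_wilf_equiv (compositions s A) [[1, 3], [1, 2]] [[1, 2], [1, 3]] \<and>
     strongly_wilf_equiv (compositions s A) [[1, 2], [2, 3]] [[2, 1], [3, 2]] \<and>
     strongly_wilf_equiv (compositions s A) [[1, 3], [2, 3]] [[2, 3], [1, 3]] \<and>
     strongly_wilf_equiv (compositions s A) [[1, 4], [2, 3]] [[2, 3], [1, 4]] \<and>
     strongly_wilf_equiv (compositions s A) [[1, 3], [2, 4]] [[2, 4], [1, 3]] \<and>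

     strongly_wilf_equiv (compositions s A) [[1], [1], [1, 2]] [[1], [1], [2, 1]] \<and>
     strongly_wilf_equiv (compositions s A) [[2], [2], [1, 2]] [[2], [2], [2, 1]] \<and>
     strongly_wilf_equiv (compositions s A) [[2], [2], [1, 3]] [[2], [2], [3, 1]] \<and>

     strongly_wilf_equiv (compositions s A) [[1], [1, 2], [2]] [[1], [2, 1], [2]] \<and>
     strongly_wilf_equiv (compositions s A) [[1], [1, 3], [2]] [[1], [3, 1], [2]] \<and>
     strongly_wilf_equiv (compositions s A) [[2], [1, 3], [3]] [[2], [3, 1], [3]] \<and>
     strongly_wilf_equiv (compositions s A) [[2], [1, 4], [3]] [[2], [4, 1], [3]]"
  \<comment> \<open>A one-letter block equals its reverse, so \<open>map rev\<close> affects only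
    the longer blocks; the pairs that exchange two blocks come from \<open>rev\<close>.\<close>
  using runs_map_rev[THEN compositions_map_rev, of s A] runs_rev[THEN compositions_rev, of s A]
  by simp

end
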